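(* Let $(\rho(\theta))_{\theta\in\mathbb{R}^L}$ be a second-order differentiable family of positive definite states on a finite-dimensional Hilbert space. For $\alpha=2$, the Petz--Rényi information matrix equals the RLD information matrix: $$\overline I_2(\theta)=I_{\mathrm{RLD}}(\theta).$$
   Context: A state is a positive semi-definite operator of unit trace. For positive definite states $\rho,\sigma$ and $\alpha\in(0,1)\cup(1,\infty)$, the Petz--Rényi relative entropy is $\overline D_\alpha(\rho\|\sigma):=\frac{1}{\alpha-1}\ln\mathrm{Tr}[\rho^\alpha\sigma^{1-\alpha}]$, and the Petz--Rényi information matrix has entries $[\overline I_\alpha(\theta)]_{i,j}:=\frac1\alpha\left.\frac{\partial^2}{\partial\varepsilon_i\partial\varepsilon_j}\overline D_\alpha(\rho(\theta)\|\rho(\theta+\varepsilon))\right|_{\varepsilon=0}$. The right-logarithmic derivative (RLD) information matrix has entries $[I_{\mathrm{RLD}}(\theta)]_{i,j}:=\mathrm{Re}\,\mathrm{Tr}[(\partial_i\rho(\theta))\rho(\theta)^{-1}(\partial_j\rho(\theta))]=\frac12\mathrm{Tr}[\{\partial_i\rho(\theta),\partial_j\rho(\theta)\}\rho(\theta)^{-1}]$, where $\partial_i=\partial/\partial\theta_i$ and $\{A,B\}=AB+BA$. *)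

theory Defs
  imports "HOL-Analysis.Analysis"
begin

(* Operators on a Hilbert space of dimension CARD('n) are matrices complex^'n^'n
   in an orthonormal basis. *)

definition conj_transpose :: "complex^'n^'m \<Rightarrow> complex^'m^'n" where
  "conj_transpose A = (\<chi> i j. cnj (A $ j $ i))"

definition hermitian :: "complex^'n^'n \<Rightarrow> bool" where
  "hermitian A \<longleftrightarrow> conj_transpose A = A"

definition unitary :: "complex^'n^'n \<Rightarrow> bool" where
  "unitary U \<longleftrightarrow> conj_transpose U ** U = mat 1 \<and> U ** conj_transpose U = mat 1"

definition real_diag :: "('n \<Rightarrow> real) \<Rightarrow> complex^'n^'n" where
  "real_diag d = (\<chi> i j. if i = j then complex_of_real (d i) else 0)"

(* The sesquilinear expectation value, conjugate-linear in its first slot. *)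
definition quad_form :: "complex^'n^'n \<Rightarrow> complex^'n \<Rightarrow> complex" where
  "quad_form A x = (\<Sum>i\<in>UNIV. cnj (x $ i) * (A *v x) $ i)"

definition positive_semidefinite :: "complex^'n^'n \<Rightarrow> bool" where
  "positive_semidefinite A \<longleftrightarrow> hermitian A \<and> (\<forall>x. 0 \<le> Re (quad_form A x))"

definition positive_definite :: "complex^'n^'n \<Rightarrow> bool" where
  "positive_definite A \<longleftrightarrow> hermitian A \<and> (\<forall>x. x \<noteq> 0 \<longrightarrow> 0 < Re (quad_form A x))"

definition quantum_state :: "complex^'n^'n \<Rightarrow> bool" where
  "quantum_state A \<longleftrightarrow> positive_semidefinite A \<and> trace A = 1"

(* Functional calculus: a spectral decomposition exists for every Hermitian A, and
   the resulting B does not depend on the one chosen.  Only meaningful for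
   positive definite A, where all eigenvalues d i are positive. *)
definition matrix_powr :: "complex^'n^'n \<Rightarrow> real \<Rightarrow> complex^'n^'n" where
  "matrix_powr A s = (THE B. \<exists>U d. unitary U
      \<and> A = U ** real_diag d ** conj_transpose U
      \<and> B = U ** real_diag (\<lambda>i. d i powr s) ** conj_transpose U)"

(* For positive definite arguments the trace is real and positive, so taking the
   real part loses nothing.  Intended for \<alpha> in (0,1) \<union> (1,\<infinity>). *)
definition petz_renyi :: "real \<Rightarrow> complex^'n^'n \<Rightarrow> complex^'n^'n \<Rightarrow> real" where
  "petz_renyi \<alpha> \<rho> \<sigma> =
     1 / (\<alpha> - 1) * ln (Re (trace (matrix_powr \<rho> \<alpha> ** matrix_powr \<sigma> (1 - \<alpha>))))"

(* The i-th partial derivative of f at x; an unspecified value if it does not exist. *)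
definition partial_deriv ::
    "'l::finite \<Rightarrow> (real^'l \<Rightarrow> 'b::real_normed_vector) \<Rightarrow> real^'l \<Rightarrow> 'b" where
  "partial_deriv i f x = vector_derivative (\<lambda>t. f (x + t *\<^sub>R axis i 1)) (at 0)"

definition twice_differentiable ::
    "('a::real_normed_vector \<Rightarrow> 'b::real_normed_vector) \<Rightarrow> bool" where
  "twice_differentiable f \<longleftrightarrow>
     (\<exists>f' :: 'a \<Rightarrow> 'a \<Rightarrow>\<^sub>L 'b.
        (\<forall>x. (f has_derivative blinfun_apply (f' x)) (at x)) \<and> (\<forall>x. f' differentiable (at x)))"

definition petz_renyi_info ::
    "real \<Rightarrow> (real^'l \<Rightarrow> complex^'n^'n) \<Rightarrow> real^'l \<Rightarrow> real^'l^'l" where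
  "petz_renyi_info \<alpha> \<rho> \<theta> =
     (\<chi> i j. 1 / \<alpha> *
        partial_deriv i (partial_deriv j (\<lambda>\<epsilon>. petz_renyi \<alpha> (\<rho> \<theta>) (\<rho> (\<theta> + \<epsilon>)))) 0)"

definition rld_info :: "(real^'l \<Rightarrow> complex^'n^'n) \<Rightarrow> real^'l \<Rightarrow> real^'l^'l" where
  "rld_info \<rho> \<theta> =
     (\<chi> i j. Re (trace (partial_deriv i \<rho> \<theta> ** matrix_inv (\<rho> \<theta>) ** partial_deriv j \<rho> \<theta>)))"

end

theory Submission imports Defs begin

text \<open>
  For \<alpha> = 2 the divergence is ln F with F(\<epsilon>) = Re Tr[\<rho>^2 \<sigma>^(-1)], where \<rho> = \<rho>(\<theta>) and
  \<sigma> = \<rho>(\<theta> + \<epsilon>), so only the operator inverse has to be differentiated.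
  As Tr \<sigma> = 1, all derivatives of \<sigma> are traceless, so F = 1 and dF = 0 at
  \<epsilon> = 0 and the Hessian of ln F there is that of F. Differentiating the inverse twice and
  dropping the traceless second derivative of \<sigma> leaves
  Tr[(\<partial>i \<rho>) \<rho>^(-1) (\<partial>j \<rho>)] + Tr[(\<partial>j \<rho>) \<rho>^(-1) (\<partial>i \<rho>)], two complex conjugate numbers.
\<close>

section \<open>Spectral theorem for Hermitian matrices\<close>

text \<open>Maximise the quadratic form over the unit sphere of \<open>W\<close>: a maximiser exists
  by compactness and is an eigenvector. Working inside an invariant subspace allows eigenvectors to
  be split off one at a time.\<close>

lemma selfadjoint_eigenvector_exists:
  fixes A :: "'a::euclidean_space \<Rightarrow> 'a"
  assumes lin: "linear A" and sym: "\<And>x y. A x \<bullet> y = x \<bullet> A y"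
    and W: "subspace W" "A ` W \<subseteq> W" and ne: "w \<in> W" "w \<noteq> 0"
  obtains x c where "x \<in> W" "norm x = 1" "A x = c *\<^sub>R x"
proof -
  interpret linear A by (rule lin)
  have cont: "continuous_on S (\<lambda>x. x \<bullet> A x)" for S
    by (intro continuous_intros linear_continuous_on linear_conv_bounded_linear[THEN iffD1] lin)
  have "compact (sphere 0 1 \<inter> W)"
    using W closed_subspace by (intro compact_Int_closed) auto
  moreover have "w /\<^sub>R norm w \<in> sphere 0 1 \<inter> W"
    using ne W by (simp add: subspace_scale)
  ultimately obtain x where x: "x \<in> sphere 0 1 \<inter> W"
    and max: "\<And>y. y \<in> sphere 0 1 \<inter> W \<Longrightarrow> y \<bullet> A y \<le> x \<bullet> A x"
    using continuous_attains_sup[OF _ _ cont] by (metis (no_types, lifting) empty_iff)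
  define c where "c = x \<bullet> A x"
  have le: "y \<bullet> A y \<le> c * (y \<bullet> y)" if "y \<in> W" for y
  proof (cases "y = 0")
    case False
    then have "y /\<^sub>R norm y \<in> sphere 0 1 \<inter> W"
      using that W by (simp add: subspace_scale)
    from max[OF this] have "(y \<bullet> A y) / (norm y)\<^sup>2 \<le> c"
      by (simp add: c_def scale divide_simps power2_eq_square)
    then show ?thesis
      using False by (simp add: divide_simps dot_square_norm mult.commute)
  qed (simp add: zero)
  have xx: "x \<bullet> x = 1" using x by (simp add: dot_square_norm)
  define z where "z = A x - c *\<^sub>R x"
  define K where "K = c * (z \<bullet> z) - z \<bullet> A z"
  have zW: "z \<in> W"
    using W x unfolding z_def by (intro subspace_diff subspace_scale) auto
  have K: "K \<ge> 0" using le[OF zW] by (simp add: K_def)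
  \<comment> \<open>First-order optimality of \<open>x\<close> in the direction of the residual \<open>z\<close> forces \<open>z = 0\<close>.\<close>
  have "2 * t * (z \<bullet> z) \<le> t\<^sup>2 * K" for t
  proof -
    have "x + t *\<^sub>R z \<in> W"
      using W x zW by (intro subspace_add subspace_scale) auto
    from le[OF this] have 1: "(x + t *\<^sub>R z) \<bullet> A (x + t *\<^sub>R z) \<le> c * ((x + t *\<^sub>R z) \<bullet> (x + t *\<^sub>R z))" .
    have 2: "x \<bullet> A z = z \<bullet> A x" using sym[of x z] by (simp add: inner_commute)
    have 3: "(x + t *\<^sub>R z) \<bullet> A (x + t *\<^sub>R z) = c + 2 * t * (z \<bullet> A x) + t\<^sup>2 * (z \<bullet> A z)"
      by (simp add: add scale inner_add_left inner_add_right 2 c_def power2_eq_square algebra_simps)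
    have 4: "(x + t *\<^sub>R z) \<bullet> (x + t *\<^sub>R z) = 1 + 2 * t * (z \<bullet> x) + t\<^sup>2 * (z \<bullet> z)"
      by (simp add: inner_add_left inner_add_right xx inner_commute power2_eq_square algebra_simps)
    have 5: "z \<bullet> z = z \<bullet> A x - c * (z \<bullet> x)"
      by (subst (2) z_def) (simp add: inner_diff_right)
    show ?thesis using 1 unfolding 3 4 K_def
      by (subst 5) (simp add: algebra_simps)
  qed
  \<comment> \<open>For small positive \<open>t\<close> the linear term outweighs the quadratic one
    unless \<open>z = 0\<close>. This \<open>t\<close> is small enough, and the added 1 keeps its
    denominator positive when \<open>K = 0\<close>.\<close>
  from this[of "(z \<bullet> z) / (K + 1)"] K have "2 * (z \<bullet> z)\<^sup>2 * (K + 1) \<le> (z \<bullet> z)\<^sup>2 * K"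
    by (simp add: divide_simps power2_eq_square split: if_splits)
  then have "(z \<bullet> z)\<^sup>2 * (K + 2) \<le> 0" by (simp add: algebra_simps)
  then have "z = 0" using K by (simp add: mult_le_0_iff)
  then show ?thesis using that[of x c] x by (simp add: z_def)
qed

text \<open>The complex inner product, whose real part is the type-class inner product. This link
  carries the real variational argument above over to complex vectors.\<close>

definition cinner :: "complex^'n \<Rightarrow> complex^'n \<Rightarrow> complex" where
  "cinner x y = (\<Sum>i\<in>UNIV. cnj (x $ i) * y $ i)"

lemma inner_eq_Re_cinner: "x \<bullet> y = Re (cinner x y)"
  by (simp add: cinner_def inner_vec_def inner_complex_def)

lemma cinner_eq_0_iff: "cinner x y = 0 \<longleftrightarrow> x \<bullet> y = 0 \<and> (\<i> *s x) \<bullet> y = 0"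
proof -
  have "(\<i> *s x) \<bullet> y = Im (cinner x y)"
    by (simp add: cinner_def inner_vec_def inner_complex_def algebra_simps)
  then show ?thesis by (auto simp: inner_eq_Re_cinner complex_eq_iff)
qed

lemma cinner_commute: "cinner x y = cnj (cinner y x)"
  by (simp add: cinner_def mult.commute)

lemma cinner_self: "cinner x x = of_real ((norm x)\<^sup>2)"
proof -
  have "Im (cinner x x) = 0" by (simp add: cinner_def mult.commute)
  then show ?thesis
    by (simp add: complex_eq_iff inner_eq_Re_cinner[symmetric] dot_square_norm)
qed

lemma cinner_hermitian:
  assumes "hermitian A"
  shows "cinner (A *v x) y = cinner x (A *v y)"
proof -
  have A: "cnj (A $ i $ j) = A $ j $ i" for i j
    using arg_cong[OF assms[unfolded hermitian_def], of "\<lambda>B. B $ j $ i"]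
    by (simp add: conj_transpose_def)
  have "cinner (A *v x) y = (\<Sum>i\<in>UNIV. \<Sum>j\<in>UNIV. A $ j $ i * cnj (x $ j) * y $ i)"
    by (simp add: cinner_def matrix_vector_mult_def sum_distrib_right A)
  also have "\<dots> = (\<Sum>j\<in>UNIV. \<Sum>i\<in>UNIV. A $ j $ i * cnj (x $ j) * y $ i)"
    by (rule sum.swap)
  also have "\<dots> = cinner x (A *v y)"
    by (simp add: cinner_def matrix_vector_mult_def sum_distrib_left mult_ac)
  finally show ?thesis .
qed

lemma linear_matrix_vector_complex: "linear ((*v) (A :: complex^'n^'m))"
  by (auto intro!: linearI simp: matrix_vector_mult_def vec_eq_iff scaleR_sum_right
      sum.distrib algebra_simps)

text \<open>Induction on \<open>I\<close>: since \<open>A\<close> is Hermitian, the orthogonal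
  complement of the eigenvectors found so far is invariant under \<open>A\<close>. It is nonzero by
  a dimension count, so it supplies the next eigenvector.\<close>

lemma hermitian_orthonormal_eigenvectors:
  fixes A :: "complex^'n^'n" and I :: "'n set"
  assumes H: "hermitian A"
  shows "\<exists>v (d :: 'n \<Rightarrow> real). \<forall>i\<in>I. A *v v i = d i *\<^sub>R v i \<and>
    (\<forall>j\<in>I. cinner (v i) (v j) = (if i = j then 1 else 0))"
  using finite[of I]
proof (induction I)
  case empty
  then show ?case by simp
next
  case (insert k I)
  from insert.IH obtain v d where
    eig: "\<And>i. i \<in> I \<Longrightarrow> A *v v i = (d i :: real) *\<^sub>R v i" and
    orth: "\<And>i j. i \<in> I \<Longrightarrow> j \<in> I \<Longrightarrow> cinner (v i) (v j) = (if i = j then 1 else 0)"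
    by blast
  \<comment> \<open>Real orthogonality to both \<open>v i\<close> and \<open>\<i> v i\<close> is complex orthogonality to \<open>v i\<close>.\<close>
  define W where "W = {y. \<forall>i\<in>I. cinner (v i) y = 0}"
  define S where "S = v ` I \<union> (\<lambda>i. \<i> *s v i) ` I"
  have "card I < CARD('n)"
    using insert.hyps by (metis UNIV_I finite psubset_card_mono psubsetI subset_UNIV)
  \<comment> \<open>Dimensions here are real: \<open>complex^'n\<close> has dimension
    \<open>2 * CARD('n)\<close>, and \<open>S\<close> contains at most two vectors per index in
    \<open>I\<close>.\<close>
  then have "dim S < DIM(complex^'n)"
  proof -
    have "dim S \<le> card S" using insert.hyps by (intro dim_le_card') (auto simp: S_def)
    also have "\<dots> \<le> card I + card I"
      unfolding S_def by (intro card_Un_le[THEN order_trans] add_mono card_image_le insert.hyps)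
    finally show ?thesis using \<open>card I < CARD('n)\<close> by simp
  qed
  then obtain w where w: "w \<noteq> 0" "\<And>y. y \<in> span S \<Longrightarrow> orthogonal w y"
    using orthogonal_to_subspace_exists by blast
  have "w \<in> W"
    using w(2)[OF span_base] by (simp add: W_def S_def cinner_eq_0_iff orthogonal_def inner_commute[of _ w])
  moreover have "subspace W"
    by (auto simp: W_def subspace_def cinner_eq_0_iff inner_add_right)
  moreover have "((*v) A) ` W \<subseteq> W"
    using eig by (auto simp: W_def cinner_hermitian[OF H, symmetric])
      (auto simp: cinner_def scaleR_sum_right[symmetric] algebra_simps)
  moreover have "(A *v x) \<bullet> y = x \<bullet> (A *v y)" for x y
    by (simp add: inner_eq_Re_cinner cinner_hermitian[OF H])
  ultimately obtain x c where x: "x \<in> W" "norm x = 1" "A *v x = c *\<^sub>R x"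
    using w(1) selfadjoint_eigenvector_exists[OF linear_matrix_vector_complex] by metis
  have "cinner x x = 1" using x(2) by (simp add: cinner_self)
  moreover have "cinner (v i) x = 0" "cinner x (v i) = 0" if "i \<in> I" for i
    using x(1) that cinner_commute[of x "v i"] by (auto simp: W_def)
  ultimately show ?case
    using insert.hyps eig orth x(3)
    by (intro exI[of _ "v(k := x)"] exI[of _ "d(k := c)"]) auto
qed

theorem hermitian_spectral_decomposition:
  fixes A :: "complex^'n^'n"
  assumes "hermitian A"
  obtains U d where "unitary U" "A = U ** real_diag d ** conj_transpose U"
proof -
  from hermitian_orthonormal_eigenvectors[OF assms, of UNIV]
  obtain v :: "'n \<Rightarrow> complex^'n" and d where vd: "\<forall>i\<in>UNIV. A *v v i = (d i :: real) *\<^sub>R v i \<and>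
      (\<forall>j\<in>UNIV. cinner (v i) (v j) = (if i = j then 1 else 0))" by (elim exE)
  then have eig: "A *v v i = d i *\<^sub>R v i"
    and orth: "cinner (v i) (v j) = (if i = j then 1 else 0)" for i j by auto
  define U where "U = (\<chi> a b. v b $ a)"
  have 1: "conj_transpose U ** U = mat 1"
    using orth by (simp add: vec_eq_iff U_def conj_transpose_def matrix_matrix_mult_def mat_def cinner_def)
  then have 2: "U ** conj_transpose U = mat 1" using matrix_left_right_inverse by blast
  have "A ** U = U ** real_diag d"
    using eig by (simp add: vec_eq_iff U_def real_diag_def matrix_matrix_mult_def
        matrix_vector_mult_def mult_delta_right scaleR_conv_of_real[where 'a=complex] mult.commute)
  then have "A = U ** real_diag d ** conj_transpose U"
    by (metis 2 matrix_mul_assoc matrix_mul_rid)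
  with 1 2 show ?thesis using that by (auto simp: unitary_def)
qed

section \<open>Matrix powers with exponents 2 and -1\<close>

lemma real_diag_mult: "real_diag d ** real_diag e = real_diag (\<lambda>i. d i * e i)"
  by (simp add: vec_eq_iff real_diag_def matrix_matrix_mult_def mult_delta_left mult_delta_right)

lemma unitary_conj_mult:
  assumes "unitary U"
  shows "(U ** D ** conj_transpose U) ** (U ** E ** conj_transpose U) = U ** (D ** E) ** conj_transpose U"
  using assms unfolding unitary_def by (metis matrix_mul_assoc matrix_mul_lid)

text \<open>Column \<open>i\<close> of \<open>U\<close> is an eigenvector for \<open>d i\<close>, so
  the quadratic form there is \<open>d i\<close> times a positive squared norm.\<close>

lemma positive_definite_eigenvalue_pos:
  assumes "positive_definite (U ** real_diag d ** conj_transpose U)" "unitary U"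
  shows "d i > 0"
proof -
  let ?A = "U ** real_diag d ** conj_transpose U"
  let ?x = "U *v axis i 1"
  have x0: "?x \<noteq> 0"
    using assms(2) unfolding unitary_def
    by (metis axis_eq_0_iff matrix_vector_mul_assoc matrix_vector_mul_lid matrix_vector_mult_0_right zero_neq_one)
  have "?A *v ?x = U *v (real_diag d *v ((conj_transpose U ** U) *v axis i 1))"
    by (simp add: matrix_vector_mul_assoc matrix_mul_assoc)
  also have "real_diag d *v ((conj_transpose U ** U) *v axis i 1) = d i *\<^sub>R axis i 1"
    using assms(2) by (intro vec_eq_iff[THEN iffD2] allI) (simp add: unitary_def mat_def real_diag_def matrix_vector_mult_def
        axis_def mult_delta_left mult_delta_right scaleR_conv_of_real[where 'a=complex])
  also have "U *v (d i *\<^sub>R axis i 1) = d i *\<^sub>R ?x" using linear_matrix_vector_complex[of U] by (simp add: linear_scale)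
  finally have "quad_form ?A ?x = d i *\<^sub>R cinner ?x ?x"
    by (simp add: quad_form_def cinner_def scaleR_sum_right)
  then have "Re (quad_form ?A ?x) = d i * (norm ?x)\<^sup>2" by (simp add: cinner_self)
  moreover have "Re (quad_form ?A ?x) > 0" using assms(1) x0 by (simp add: positive_definite_def)
  ultimately show ?thesis using x0 by (simp add: zero_less_mult_iff)
qed

text \<open>Resolves the definite description in \<open>matrix_powr\<close>: the spectral theorem
  gives existence, and uniqueness holds because one \<open>B\<close> serves all
  decompositions.\<close>

lemma matrix_powr_eqI:
  assumes "positive_definite A"
    and "\<And>U d. unitary U \<Longrightarrow> (\<And>i. d i > 0) \<Longrightarrow> A = U ** real_diag d ** conj_transpose U
      \<Longrightarrow> U ** real_diag (\<lambda>i. d i powr s) ** conj_transpose U = B"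
  shows "matrix_powr A s = B"
proof -
  have eq: "U ** real_diag (\<lambda>i. d i powr s) ** conj_transpose U = B"
    if "unitary U" "A = U ** real_diag d ** conj_transpose U" for U d
    using that assms positive_definite_eigenvalue_pos[of U d] by simp
  obtain U d where "unitary U" "A = U ** real_diag d ** conj_transpose U"
    using assms(1) hermitian_spectral_decomposition unfolding positive_definite_def by blast
  with eq show ?thesis
    unfolding matrix_powr_def by (intro the_equality) blast+
qed

lemma matrix_powr_2:
  fixes A :: "complex^'n^'n"
  assumes "positive_definite A"
  shows "matrix_powr A 2 = A ** A"
proof (rule matrix_powr_eqI[OF assms])
  fix U :: "complex^'n^'n" and d :: "'n \<Rightarrow> real"
  assume *: "unitary U" "\<And>i. d i > 0" "A = U ** real_diag d ** conj_transpose U"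
  have "d i powr 2 = d i * d i" for i
    using *(2)[of i] by (simp add: power2_eq_square)
  with *(1) show "U ** real_diag (\<lambda>i. d i powr 2) ** conj_transpose U = A ** A"
    by (simp add: *(3) unitary_conj_mult real_diag_mult)
qed

lemma matrix_inv_eqI:
  fixes A B :: "'a::field^'n^'n"
  assumes "A ** B = mat 1"
  shows "matrix_inv A = B"
proof -
  have BA: "B ** A = mat 1" using assms matrix_left_right_inverse by blast
  have "C = B" if "A ** C = mat 1" for C
    using BA that matrix_mul_assoc[of B A C] by simp
  with assms BA show ?thesis
    unfolding matrix_inv_def by (intro some_equality conjI) blast+
qed

lemma unitary_conj_inverse:
  assumes "unitary U" "\<And>i. d i > 0"
  shows "(U ** real_diag d ** conj_transpose U) ** (U ** real_diag (\<lambda>i. d i powr (-1)) ** conj_transpose U) = mat 1"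
proof -
  have "d i * d i powr (-1) = 1" for i
    using assms(2)[of i] by (simp add: powr_minus_divide)
  then have "real_diag d ** real_diag (\<lambda>i. d i powr (-1)) = mat 1"
    unfolding real_diag_mult by (simp add: vec_eq_iff real_diag_def mat_def)
  then show ?thesis
    using assms(1) by (simp add: unitary_conj_mult) (simp add: unitary_def)
qed

lemma matrix_powr_minus_1:
  fixes A :: "complex^'n^'n"
  assumes "positive_definite A"
  shows "matrix_powr A (-1) = matrix_inv A"
proof (rule matrix_powr_eqI[OF assms])
  fix U :: "complex^'n^'n" and d :: "'n \<Rightarrow> real"
  assume *: "unitary U" "\<And>i. d i > 0" "A = U ** real_diag d ** conj_transpose U"
  show "U ** real_diag (\<lambda>i. d i powr (-1)) ** conj_transpose U = matrix_inv A"
    unfolding *(3) by (rule matrix_inv_eqI[symmetric]) (rule unitary_conj_inverse[OF *(1,2)])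
qed

lemma positive_definite_matrix_inv:
  assumes "positive_definite A"
  shows "A ** matrix_inv A = mat 1" "matrix_inv A ** A = mat 1"
proof -
  obtain U d where U: "unitary U" "A = U ** real_diag d ** conj_transpose U"
    using assms hermitian_spectral_decomposition unfolding positive_definite_def by blast
  with assms have "A ** (U ** real_diag (\<lambda>i. d i powr (-1)) ** conj_transpose U) = mat 1"
    using unitary_conj_inverse[OF U(1)] positive_definite_eigenvalue_pos[of U d] by blast
  with matrix_inv_eqI[OF this] show "A ** matrix_inv A = mat 1" by simp
  then show "matrix_inv A ** A = mat 1" using matrix_left_right_inverse by blast
qed

section \<open>Derivatives of matrix products and inverses\<close>

lemma bounded_bilinear_matrix_mult:
  "bounded_bilinear ((**) :: complex^'n^'m \<Rightarrow> complex^'p^'n \<Rightarrow> complex^'p^'m)"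
  unfolding bilinear_conv_bounded_bilinear[symmetric] bilinear_def
  by (auto intro!: linearI simp: matrix_add_ldistrib matrix_scalar_ac scalar_matrix_assoc
      vec_eq_iff matrix_matrix_mult_def sum.distrib algebra_simps scaleR_sum_right)

lemma bounded_linear_Re_trace: "bounded_linear (\<lambda>A :: complex^'n^'n. Re (trace A))"
  unfolding linear_conv_bounded_linear[symmetric]
  by (auto intro!: linearI simp: trace_def sum.distrib scaleR_sum_right sum_distrib_left)

text \<open>Once \<open>e x < 1/2\<close>, the bound can be solved for \<open>norm (f x)\<close>,
  giving at most \<open>2 * norm l\<close>. The error is then controlled by \<open>e\<close>
  alone.\<close>

lemma tendsto_of_left_factor_bound:
  fixes f :: "'a \<Rightarrow> 'b::real_normed_vector" and e :: "'a \<Rightarrow> real"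
  assumes bound: "\<And>x. norm (f x - l) \<le> norm (f x) * e x" and e: "(e \<longlongrightarrow> 0) F"
  shows "(f \<longlongrightarrow> l) F"
proof -
  have "eventually (\<lambda>x. e x < 1/2) F"
    using order_tendstoD(2)[OF e, of "1/2"] by simp
  then have "eventually (\<lambda>x. norm (f x - l) \<le> 2 * norm l * \<bar>e x\<bar>) F"
  proof eventually_elim
    case (elim x)
    have "norm (f x) \<le> norm l + norm (f x - l)" by (metis add.commute diff_add_cancel norm_triangle_ineq)
    also have "\<dots> \<le> norm l + norm (f x) * (1/2)"
      using bound[of x] elim by (smt (verit) mult_left_mono norm_ge_zero)
    finally have "norm (f x) \<le> 2 * norm l" by simp
    then show ?case
      using bound[of x] by (smt (verit) mult_left_mono mult_right_mono norm_ge_zero)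
  qed
  moreover have "((\<lambda>x. 2 * norm l * \<bar>e x\<bar>) \<longlongrightarrow> 0) F"
    using tendsto_mult_left[OF tendsto_rabs_zero[OF e]] by (simp add: tendsto_mult_right_zero)
  ultimately show ?thesis
    by (rule LIM_zero_cancel[OF Lim_null_comparison])
qed

text \<open>In this form an exact identity for the difference quotient can be passed directly to the
  limit.\<close>

lemma has_vector_derivative_iff_quotient:
  fixes f :: "real \<Rightarrow> 'b::real_normed_vector"
  shows "(f has_vector_derivative D) (at a) \<longleftrightarrow> ((\<lambda>t. (f t - f a) /\<^sub>R (t - a)) \<longlongrightarrow> D) (at a)"
proof -
  have eq: "norm ((f t - f a) - (t - a) *\<^sub>R D) / norm (t - a) = norm ((f t - f a) /\<^sub>R (t - a) - D)"
    if "t \<noteq> a" for t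
  proof -
    have "(f t - f a) /\<^sub>R (t - a) - D = ((f t - f a) - (t - a) *\<^sub>R D) /\<^sub>R (t - a)"
      using that by (simp add: scaleR_diff_right)
    then show ?thesis by (simp add: divide_inverse mult.commute)
  qed
  have "(f has_vector_derivative D) (at a) \<longleftrightarrow>
      ((\<lambda>t. norm ((f t - f a) - (t - a) *\<^sub>R D) / norm (t - a)) \<longlongrightarrow> 0) (at a)"
    by (simp add: has_vector_derivative_def has_derivative_iff_norm bounded_linear_scaleR_left)
  also have "\<dots> \<longleftrightarrow> ((\<lambda>t. norm ((f t - f a) /\<^sub>R (t - a) - D)) \<longlongrightarrow> 0) (at a)"
    by (intro Lim_cong_within) (simp_all add: eq del: real_norm_def)
  also have "\<dots> \<longleftrightarrow> ((\<lambda>t. (f t - f a) /\<^sub>R (t - a)) \<longlongrightarrow> D) (at a)"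
    unfolding tendsto_norm_zero_iff by (rule LIM_zero_iff)
  finally show ?thesis .
qed

text \<open>Divide the resolvent identity \<open>diff\<close> by \<open>t - a\<close> and let
  \<open>t\<close> tend to \<open>a\<close>.\<close>

lemma has_vector_derivative_matrix_inverse:
  fixes S X :: "real \<Rightarrow> complex^'n^'n"
  assumes inv: "\<And>t. S t ** X t = mat 1" "\<And>t. X t ** S t = mat 1"
    and S: "(S has_vector_derivative D) (at a)"
  shows "(X has_vector_derivative - (X a ** D ** X a)) (at a)"
proof -
  interpret mm: bounded_bilinear "(**) :: complex^'n^'n \<Rightarrow> complex^'n^'n \<Rightarrow> complex^'n^'n"
    by (rule bounded_bilinear_matrix_mult)
  obtain K where K: "K > 0" "\<And>(A :: complex^'n^'n) (B :: complex^'n^'n). norm (A ** B) \<le> norm A * norm B * K"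
    using mm.pos_bounded by blast
  have diff: "X t - X a = - (X t ** ((S t - S a) ** X a))" for t
  proof -
    have "X t ** ((S t - S a) ** X a) = X t ** S t ** X a - X t ** (S a ** X a)"
      by (simp add: mm.diff_left mm.diff_right matrix_mul_assoc)
    then show ?thesis by (simp add: inv)
  qed
  have S_lim: "(S \<longlongrightarrow> S a) (at a)"
    using has_vector_derivative_continuous[OF S] by (simp add: continuous_within)
  \<comment> \<open>Continuity of the inverse comes first, because \<open>X t\<close> still occurs
    on the right of \<open>diff\<close>.\<close>
  have X_lim: "(X \<longlongrightarrow> X a) (at a)"
  proof (rule tendsto_of_left_factor_bound)
    show "norm (X t - X a) \<le> norm (X t) * (norm ((S t - S a) ** X a) * K)" for t
      using K(2)[of "X t" "(S t - S a) ** X a"] by (simp add: diff mult.assoc)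
    show "((\<lambda>t. norm ((S t - S a) ** X a) * K) \<longlongrightarrow> 0) (at a)"
      using S_lim by (intro tendsto_mult_left_zero tendsto_norm_zero mm.tendsto_left_zero LIM_zero)
  qed
  have "((\<lambda>t. - (X t ** (((S t - S a) /\<^sub>R (t - a)) ** X a))) \<longlongrightarrow> - (X a ** (D ** X a))) (at a)"
    using S unfolding has_vector_derivative_iff_quotient
    by (intro tendsto_minus mm.tendsto X_lim tendsto_const)
  moreover have "- (X t ** (((S t - S a) /\<^sub>R (t - a)) ** X a)) = (X t - X a) /\<^sub>R (t - a)" for t
    by (simp add: diff mm.scaleR_left mm.scaleR_right)
  ultimately show ?thesis
    by (simp add: has_vector_derivative_iff_quotient matrix_mul_assoc)
qed

lemma has_vector_derivative_along_line:
  assumes "(f has_derivative f') (at x)"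
  shows "((\<lambda>t. f (x + t *\<^sub>R v)) has_vector_derivative f' v) (at 0)"
proof -
  interpret f': bounded_linear f' using assms by (rule has_derivative_bounded_linear)
  have "((\<lambda>t. x + t *\<^sub>R v) has_derivative (\<lambda>t. t *\<^sub>R v)) (at 0)"
    by (auto intro!: derivative_eq_intros)
  from diff_chain_at[OF this, of f f'] assms show ?thesis
    by (simp add: has_vector_derivative_def o_def f'.scaleR)
qed

lemma partial_deriv_eqI:
  assumes "((\<lambda>t. f (x + t *\<^sub>R axis i 1)) has_vector_derivative D) (at 0)"
  shows "partial_deriv i f x = D"
  unfolding partial_deriv_def using assms by (rule vector_derivative_at)

section \<open>Adjoints, traces and inverses\<close>

lemma conj_transpose_mult: "conj_transpose (A ** B) = conj_transpose B ** conj_transpose A"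
  by (simp add: vec_eq_iff conj_transpose_def matrix_matrix_mult_def mult.commute)

lemma trace_conj_transpose: "trace (conj_transpose A) = cnj (trace A)"
  by (simp add: trace_def conj_transpose_def)

lemma bounded_linear_conj_transpose:
  "bounded_linear (conj_transpose :: complex^'n^'m \<Rightarrow> complex^'m^'n)"
  unfolding linear_conv_bounded_linear[symmetric]
  by (auto intro!: linearI simp: conj_transpose_def vec_eq_iff)

lemma hermitian_matrix_inv:
  assumes "hermitian A" "matrix_inv A ** A = mat 1"
  shows "hermitian (matrix_inv A)"
proof -
  have "A ** conj_transpose (matrix_inv A) = conj_transpose (matrix_inv A ** A)"
    using assms(1) by (simp add: conj_transpose_mult hermitian_def)
  also have "\<dots> = mat 1"
    by (simp add: assms(2)) (simp add: conj_transpose_def mat_def vec_eq_iff)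
  finally show ?thesis unfolding hermitian_def by (rule matrix_inv_eqI[symmetric])
qed

section \<open>The Hessian of the divergence at coinciding states\<close>

theorem corollary19:
  fixes \<rho> :: "real^'l \<Rightarrow> complex^'n^'n" and \<theta> :: "real^'l"
  assumes "twice_differentiable \<rho>"
    and "\<And>\<theta>. quantum_state (\<rho> \<theta>)"
    and "\<And>\<theta>. positive_definite (\<rho> \<theta>)"
  shows "petz_renyi_info 2 \<rho> \<theta> = rld_info \<rho> \<theta>"
proof -
  interpret mm: bounded_bilinear "(**) :: complex^'n^'n \<Rightarrow> complex^'n^'n \<Rightarrow> complex^'n^'n"
    by (rule bounded_bilinear_matrix_mult)
  interpret rt: bounded_linear "\<lambda>A :: complex^'n^'n. Re (trace A)"
    by (rule bounded_linear_Re_trace)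
  from assms(1) obtain f' where f': "\<And>x. (\<rho> has_derivative blinfun_apply (f' x)) (at x)"
    and f'_diff: "\<And>x. f' differentiable (at x)"
    unfolding twice_differentiable_def by blast
  \<comment> \<open>\<open>P j\<close> and \<open>F' j\<close> are the partial derivatives of
    \<open>\<rho>\<close> and \<open>F\<close>, as \<open>d\<rho>\<close> and \<open>dF\<close>
    confirm. \<open>F\<close> is the argument of the logarithm, with \<open>R\<close> held fixed at
    the base point \<open>\<theta>\<close>.\<close>
  define P where "P j x = blinfun_apply (f' x) (axis j 1)" for j x
  define X where "X x = matrix_inv (\<rho> x)" for x
  define R where "R = \<rho> \<theta> ** \<rho> \<theta>"
  define F where "F x = Re (trace (R ** X x))" for x
  define F' where "F' j x = - Re (trace (R ** (X x ** P j x ** X x)))" for j x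
  note inv = positive_definite_matrix_inv[OF assms(3), folded X_def]
  have RX: "R ** X \<theta> = \<rho> \<theta>" "X \<theta> ** R = \<rho> \<theta>"
    by (simp_all add: R_def inv matrix_mul_assoc) (simp add: inv matrix_mul_assoc[symmetric])
  have tr_\<rho>: "Re (trace (\<rho> x)) = 1" for x
    using assms(2)[of x] by (simp add: quantum_state_def)
  have d\<rho>: "((\<lambda>t. \<rho> (x + t *\<^sub>R axis j 1)) has_vector_derivative P j x) (at 0)" for j x
    unfolding P_def by (rule has_vector_derivative_along_line[OF f'])
  have dX: "((\<lambda>t. X (x + t *\<^sub>R axis j 1)) has_vector_derivative - (X x ** P j x ** X x)) (at 0)" for j x
    using has_vector_derivative_matrix_inverse[of "\<lambda>t. \<rho> (x + t *\<^sub>R axis j 1)"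
        "\<lambda>t. X (x + t *\<^sub>R axis j 1)", OF inv d\<rho>] by simp
  have dF: "((\<lambda>t. F (x + t *\<^sub>R axis j 1)) has_vector_derivative F' j x) (at 0)" for j x
    using rt.has_vector_derivative[OF mm.has_vector_derivative[OF has_vector_derivative_const dX]]
    by (simp add: F_def F'_def mm.minus_right rt.neg)
  have tr_P: "Re (trace (P j x)) = 0" for j x
    using vector_derivative_unique_at[OF rt.has_vector_derivative[OF d\<rho>, of x j, unfolded tr_\<rho>]
        has_vector_derivative_const] .
  have F0: "F \<theta> = 1" by (simp add: F_def RX tr_\<rho>)
  \<comment> \<open>At the base point one factor of \<open>R\<close> cancels, and cyclicity of the
    trace reduces \<open>F'\<close> to minus the real trace of \<open>P j \<theta>\<close>.\<close>
  have F'0: "F' j \<theta> = 0" for j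
    using trace_mul_sym[of "\<rho> \<theta> ** P j \<theta>" "X \<theta>"]
    by (simp add: F'_def matrix_mul_assoc RX inv tr_P)
  have petz: "petz_renyi 2 (\<rho> \<theta>) (\<rho> x) = ln (F x)" for x
    by (simp add: petz_renyi_def matrix_powr_2 matrix_powr_minus_1 assms(3) F_def R_def X_def)
  \<comment> \<open>The adjoint is bounded and real-linear, so it commutes with differentiation
    along a curve of Hermitian matrices.\<close>
  have herm_P: "conj_transpose (P j x) = P j x" for j x
  proof -
    have "conj_transpose (\<rho> x) = \<rho> x" for x
      using assms(3)[of x] by (simp add: positive_definite_def hermitian_def)
    with bounded_linear.has_vector_derivative[OF bounded_linear_conj_transpose d\<rho>, of x j]
    show ?thesis using d\<rho>[of x j] vector_derivative_unique_at by simp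
  qed
  have herm_X: "conj_transpose (X x) = X x" for x
    using hermitian_matrix_inv[of "\<rho> x"] assms(3)[of x] inv[of x]
    by (simp add: positive_definite_def hermitian_def X_def)
  have "partial_deriv i (partial_deriv j (\<lambda>\<epsilon>. petz_renyi 2 (\<rho> \<theta>) (\<rho> (\<theta> + \<epsilon>)))) 0
      = 2 * Re (trace (P i \<theta> ** X \<theta> ** P j \<theta>))" (is "_ = 2 * ?I") for i j
  proof -
    let ?l = "\<lambda>t. \<theta> + t *\<^sub>R axis i 1"
    obtain f'' where "(f' has_derivative f'') (at \<theta>)"
      using f'_diff unfolding differentiable_def by blast
    \<comment> \<open>Evaluating a bounded linear map at the fixed vector \<open>axis j 1\<close> is
      itself bounded linear, so \<open>P j\<close> inherits differentiability from
      \<open>f'\<close>. \<open>Q\<close> is the mixed second derivative of \<open>\<rho>\<close> at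
      \<open>\<theta>\<close>.\<close>
    from bounded_linear.has_vector_derivative[OF bounded_bilinear.bounded_linear_left[OF bounded_bilinear_blinfun_apply]
        has_vector_derivative_along_line[OF this]]
    obtain Q where Q: "((\<lambda>t. P j (?l t)) has_vector_derivative Q) (at 0)"
      unfolding P_def by blast
    have tr_Q: "Re (trace Q) = 0"
      using vector_derivative_unique_at[OF rt.has_vector_derivative[OF Q, unfolded tr_P]
          has_vector_derivative_const] .
    let ?X = "X \<theta>" and ?Pi = "P i \<theta>" and ?Pj = "P j \<theta>"
    have "((\<lambda>t. F' j (?l t)) has_vector_derivative
        - Re (trace (R ** (?X ** ?Pj ** - (?X ** ?Pi ** ?X) + (?X ** Q + - (?X ** ?Pi ** ?X) ** ?Pj) ** ?X)))) (at 0)"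
      using has_vector_derivative_minus[OF rt.has_vector_derivative[OF mm.has_vector_derivative[OF
            has_vector_derivative_const mm.has_vector_derivative[OF mm.has_vector_derivative[OF dX Q] dX]]]]
      by (simp add: F'_def)
    \<comment> \<open>The two terms that differentiate an inverse carry a second minus sign and
      become positive; \<open>RX\<close> then removes one \<open>X \<theta>\<close> together with
      one factor of \<open>R\<close>.\<close>
    also have "- Re (trace (R ** (?X ** ?Pj ** - (?X ** ?Pi ** ?X) + (?X ** Q + - (?X ** ?Pi ** ?X) ** ?Pj) ** ?X)))
        = Re (trace (\<rho> \<theta> ** (?Pj ** ?X ** ?Pi) ** ?X)) - Re (trace (\<rho> \<theta> ** Q ** ?X))
          + Re (trace (\<rho> \<theta> ** (?Pi ** ?X ** ?Pj) ** ?X))"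
      by (simp add: mm.add_left mm.add_right mm.minus_left mm.minus_right mm.diff_left
          mm.diff_right matrix_mul_assoc RX rt.add rt.neg rt.diff)
    also have "\<dots> = 2 * ?I"
    proof -
      have cyc: "trace (\<rho> \<theta> ** A ** ?X) = trace A" for A
        using trace_mul_sym[of "\<rho> \<theta> ** A" ?X] by (simp add: matrix_mul_assoc inv)
      \<comment> \<open>Reversing the order of Hermitian factors is taking the adjoint, so the two
        remaining traces have equal real parts. This produces the factor 2.\<close>
      have "trace (?Pj ** ?X ** ?Pi) = cnj (trace (?Pi ** ?X ** ?Pj))"
        by (simp add: trace_conj_transpose[symmetric] conj_transpose_mult herm_P herm_X matrix_mul_assoc)
      then show ?thesis by (simp add: cyc tr_Q)
    qed
    finally have dF': "((\<lambda>t. F' j (?l t)) has_real_derivative 2 * ?I) (at 0)"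
      by (simp add: has_real_derivative_iff_has_vector_derivative)
    have dFi: "((\<lambda>t. F (?l t)) has_real_derivative F' i \<theta>) (at 0)"
      using dF by (simp add: has_real_derivative_iff_has_vector_derivative)
    have d_ln: "partial_deriv j (\<lambda>\<epsilon>. ln (F (\<theta> + \<epsilon>))) y = F' j (\<theta> + y) / F (\<theta> + y)"
      if "F (\<theta> + y) > 0" for y
    proof (rule partial_deriv_eqI)
      have "((\<lambda>t. F (\<theta> + y + t *\<^sub>R axis j 1)) has_real_derivative F' j (\<theta> + y)) (at 0)"
        using dF by (simp add: has_real_derivative_iff_has_vector_derivative)
      from DERIV_ln_divide[THEN DERIV_chain2, OF _ this] that
      show "((\<lambda>t. ln (F (\<theta> + (y + t *\<^sub>R axis j 1)))) has_vector_derivative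
          F' j (\<theta> + y) / F (\<theta> + y)) (at 0)"
        by (simp add: has_real_derivative_iff_has_vector_derivative[symmetric] add.assoc)
    qed
    \<comment> \<open>\<open>d_ln\<close> requires a positive argument. Continuity and
      \<open>F0\<close> give this near \<open>t = 0\<close>, and agreement of the two functions
      there determines the derivative at 0.\<close>
    have "isCont (\<lambda>t. F (?l t)) 0"
      using dFi by (rule DERIV_isCont)
    then have "eventually (\<lambda>t. F (?l t) > 0) (at 0)"
      using order_tendstoD(1)[of "\<lambda>t. F (?l t)" 1 "at 0" 0] by (simp add: isCont_def F0)
    then have "eventually (\<lambda>t. F (?l t) > 0) (nhds 0)"
      by (simp add: eventually_nhds_conv_at F0)
    then have ev: "eventually (\<lambda>t. F' j (?l t) / F (?l t)
        = partial_deriv j (\<lambda>\<epsilon>. ln (F (\<theta> + \<epsilon>))) (0 + t *\<^sub>R axis i 1)) (nhds 0)"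
      by eventually_elim (simp add: d_ln)
    \<comment> \<open>In the quotient rule, \<open>F0\<close> makes the denominator 1 and
      \<open>F'0\<close> removes the product of first derivatives.\<close>
    have "((\<lambda>t. F' j (?l t) / F (?l t)) has_real_derivative 2 * ?I) (at 0)"
      using DERIV_divide[OF dF' dFi] by (simp add: F0 F'0)
    then have "((\<lambda>t. partial_deriv j (\<lambda>\<epsilon>. ln (F (\<theta> + \<epsilon>))) (0 + t *\<^sub>R axis i 1))
        has_real_derivative 2 * ?I) (at 0)"
      using DERIV_cong_ev[OF refl ev refl] by simp
    then show ?thesis
      unfolding petz by (intro partial_deriv_eqI) (simp add: has_real_derivative_iff_has_vector_derivative)
  qed
  moreover have "partial_deriv i \<rho> \<theta> = P i \<theta>" for i
    by (rule partial_deriv_eqI[OF d\<rho>])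
  \<comment> \<open>The prefactor \<open>1 / \<alpha>\<close> equals 1/2 here and cancels the 2 in
    the Hessian.\<close>
  ultimately show ?thesis by (simp add: petz_renyi_info_def rld_info_def X_def)
qed

end
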